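(* Let $\mathcal{H}$ be a real Hilbert space and let $A:\mathcal{H}\to2^{\mathcal{H}}$ be maximally monotone with $\operatorname{zer}A\neq\varnothing$. Let $\bar x\in\operatorname{zer}A$. Suppose that $A$ is metrically subregular at $\bar x$ for $0\in A\bar x$, i.e. there exist $\kappa>0$ and $\delta>0$ such that $$(\forall x\in B[\bar x;\delta])\quad \operatorname{d}(x,A^{-1}0)\le\kappa\operatorname{d}(0,Ax).$$ For every $k\in\mathbb{N}$ let $\lambda_k\in(0,2)$, $c_k\in(0,\infty)$, $\eta_k\in[0,\infty)$ and $e_k\in\mathcal{H}$. Let $\tau\in(0,\infty)$ be such that $\tau+\sum_{k\in\mathbb{N}}\eta_k\|e_k\|\le\delta$, let $x_0\in B[\bar x;\tau]$, and define $$(\forall k\in\mathbb{N})\quad x_{k+1}=(1-\lambda_k)x_k+\lambda_kJ_{c_kA}x_k+\eta_ke_k .$$ Suppose that $\inf_{k\in\mathbb{N}}c_k>0$ and that $0<\liminf_{k\to\infty}\lambda_k\le\limsup_{k\to\infty}\lambda_k<2$. Then $(x_k)_{k\in\mathbb{N}}$ converges strongly to a point in $\operatorname{zer}A$.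
   Context: $\mathbb{N}=\{0,1,2,\ldots\}$. A set-valued operator $A:\mathcal{H}\to2^{\mathcal{H}}$ is monotone if $\langle x-y,u-v\rangle\ge0$ whenever $u\in Ax$, $v\in Ay$, and maximally monotone if no monotone operator has a graph properly containing that of $A$. $\operatorname{zer}A=A^{-1}0=\{x\in\mathcal{H}:0\in Ax\}$. For $c>0$, $J_{cA}=(\operatorname{Id}+cA)^{-1}$ is the resolvent, which for maximally monotone $A$ is single-valued and defined on all of $\mathcal{H}$. $B[\bar x;r]=\{y:\|y-\bar x\|\le r\}$; $\operatorname{d}(x,C)=\inf_{y\in C}\|x-y\|$ (equal to $+\infty$ if $C=\varnothing$). Strong convergence means convergence in norm. *)

theory Defs
  imports "HOL-Analysis.Analysis"
begin

text \<open>
  A set-valued operator on \<open>'a\<close> is a function of type \<open>'a \<Rightarrow> 'a set\<close>; a real Hilbert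
  space is a type of sort \<open>{real_inner, complete_space}\<close>.
\<close>

definition op_graph :: "('a \<Rightarrow> 'a set) \<Rightarrow> ('a \<times> 'a) set" where
  "op_graph A = {(x, u). u \<in> A x}"

definition op_inverse :: "('a \<Rightarrow> 'a set) \<Rightarrow> 'a \<Rightarrow> 'a set" where
  "op_inverse A u = {x. u \<in> A x}"

definition zer :: "('a::zero \<Rightarrow> 'a set) \<Rightarrow> 'a set" where
  "zer A = op_inverse A 0"

definition monotone_op :: "('a::real_inner \<Rightarrow> 'a set) \<Rightarrow> bool" where
  "monotone_op A \<longleftrightarrow> (\<forall>x y. \<forall>u\<in>A x. \<forall>v\<in>A y. (x - y) \<bullet> (u - v) \<ge> 0)"

definition maximally_monotone :: "('a::real_inner \<Rightarrow> 'a set) \<Rightarrow> bool" where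
  "maximally_monotone A \<longleftrightarrow>
     monotone_op A \<and> \<not> (\<exists>B. monotone_op B \<and> op_graph A \<subset> op_graph B)"

definition id_plus_scaled :: "real \<Rightarrow> ('a::real_vector \<Rightarrow> 'a set) \<Rightarrow> 'a \<Rightarrow> 'a set" where
  "id_plus_scaled c A x = {x + c *\<^sub>R u | u. u \<in> A x}"

text \<open>
  The resolvent \<open>(Id + cA)\<^sup>-\<^sup>1\<close> as a point-valued map. The description is meaningful when the
  inverse is single-valued and everywhere defined, as it is on a Hilbert space for maximally
  monotone \<open>A\<close> and \<open>c > 0\<close> (Minty).
\<close>

definition resolvent :: "real \<Rightarrow> ('a::real_vector \<Rightarrow> 'a set) \<Rightarrow> 'a \<Rightarrow> 'a" where
  "resolvent c A x = (THE p. p \<in> op_inverse (id_plus_scaled c A) x)"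

text \<open>
  Unlike the library's \<open>infdist\<close>, which is real-valued and \<open>0\<close> on the empty set, this distance
  is \<open>\<infinity>\<close> on the empty set.
\<close>

definition edist_set :: "'a::real_normed_vector \<Rightarrow> 'a set \<Rightarrow> ereal" where
  "edist_set x C = (INF y\<in>C. ereal (norm (x - y)))"

end

theory Submission
  imports Defs
begin

text \<open>
  Write \<open>Z\<close> for the zero set of \<open>A\<close>, \<open>d(-, Z)\<close> for the distance to it, \<open>p\<^sub>k\<close> for the resolvent
  point of \<open>x\<^sub>k\<close> and \<open>\<epsilon>\<^sub>k = \<eta>\<^sub>k \<parallel>e\<^sub>k\<parallel>\<close>. By monotonicity a relaxed resolvent step, before its error is
  added, lowers the squared distance to every zero by at least \<open>\<lambda>\<^sub>k (2 - \<lambda>\<^sub>k) \<parallel>x\<^sub>k - p\<^sub>k\<parallel>\<^sup>2\<close>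
  (\<open>relaxed_resolvent_step\<close>). The bound on \<open>\<tau>\<close> and the errors therefore keeps all \<open>x\<^sub>k\<close>, and all
  \<open>p\<^sub>k\<close>, in the ball around \<open>xbar\<close> where subregularity holds. Since \<open>(x\<^sub>k - p\<^sub>k) / c\<^sub>k\<close> is a value of
  \<open>A\<close> at \<open>p\<^sub>k\<close> and \<open>c\<^sub>k\<close> is bounded away from \<open>0\<close>, subregularity bounds the distance of \<open>p\<^sub>k\<close> to \<open>Z\<close>,
  hence also that of \<open>x\<^sub>k\<close>, by a multiple of \<open>\<parallel>x\<^sub>k - p\<^sub>k\<parallel>\<close>. So the drop is at least a fixed
  fraction of the squared distance to \<open>Z\<close> once \<open>\<lambda>\<^sub>k\<close> stays away from \<open>0\<close> and \<open>2\<close>. Thus, for large \<open>k\<close>,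
  \<open>d(x\<^sub>k\<^sub>+\<^sub>1, Z) \<le> \<rho> d(x\<^sub>k, Z) + \<epsilon>\<^sub>k\<close> with \<open>\<rho> < 1\<close>, and the distances to \<open>Z\<close> tend to \<open>0\<close>
  (\<open>contraction_with_summable_errors_tendsto_0\<close>). A sequence that approaches every point of \<open>Z\<close> up
  to summable errors and whose distance to \<open>Z\<close> vanishes is Cauchy, and its limit lies in \<open>Z\<close>
  (\<open>quasi_Fejer_convergent\<close>).

  All of this needs the resolvent to be defined everywhere, which is Minty's theorem
  (\<open>resolvent_mem\<close>). By maximality it suffices to find one point that is monotonically related to
  the whole graph, and such a point exists for every monotone set (\<open>Debrunner_Flor\<close>). In an
  infinite-dimensional space one would usually combine a finite minimax argument with weak
  compactness. Minimising a strongly convex function over the convex hull of the lifted graph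
  \<open>{(y, v, y \<bullet> v)}\<close> replaces both: the vector parts \<open>(y - v)/2\<close> along a minimising sequence are Cauchy, and
  completeness is enough (\<open>strongly_convex_minimiser\<close>).
\<close>

section \<open>Minty's theorem\<close>

text \<open>
  The point \<open>p\<close> is the limit of the first components of a minimising sequence of
  \<open>(a, h) \<mapsto> h + \<parallel>a\<parallel>\<^sup>2\<close>. This function is strongly convex in \<open>a\<close>, which gives convergence; the
  conclusion is the first-order optimality condition, in the direction of each point of \<open>D\<close>, with
  the infimum replaced by the lower bound \<open>m\<close>.
\<close>

lemma strongly_convex_minimiser:
  fixes D :: "('a::{real_inner, complete_space} \<times> real) set"
  assumes conv: "convex D" and ne: "D \<noteq> {}"
    and bound: "\<And>a h. (a, h) \<in> D \<Longrightarrow> m \<le> h + (norm a)\<^sup>2"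
  shows "\<exists>p. \<forall>(a, h)\<in>D. (norm (p - a))\<^sup>2 \<le> h + (norm a)\<^sup>2 - m"
proof -
  define f :: "'a \<times> real \<Rightarrow> real" where "f w = snd w + (norm (fst w))\<^sup>2" for w
  define I where "I = Inf (f ` D)"
  have f_ge_m: "m \<le> f w" if "w \<in> D" for w
    using bound[of "fst w" "snd w"] that by (simp add: f_def)
  have bdd: "bdd_below (f ` D)"
    using f_ge_m by (rule bdd_belowI2)
  have I_le: "I \<le> f w" if "w \<in> D" for w
    unfolding I_def using bdd that by (simp add: cINF_lower)
  have m_le: "m \<le> I"
    unfolding I_def using ne f_ge_m by (auto intro: cINF_greatest)
  have f_comb: "f ((1 - s) *\<^sub>R w + s *\<^sub>R w') =
      (1 - s) * f w + s * f w' - s * (1 - s) * (norm (fst w - fst w'))\<^sup>2" for s w w'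
    unfolding f_def power2_norm_eq_inner
    by (simp add: inner_diff inner_add inner_commute algebra_simps power2_eq_square)
  have seg: "I \<le> (1 - s) * f w + s * f w' - s * (1 - s) * (norm (fst w - fst w'))\<^sup>2"
    if "w \<in> D" "w' \<in> D" "0 \<le> s" "s \<le> 1" for s w w'
  proof -
    have "(1 - s) *\<^sub>R w + s *\<^sub>R w' \<in> D"
      using convexD_alt[OF conv that(1,2)] that(3,4) by blast
    then show ?thesis using I_le f_comb by metis
  qed
  have "\<exists>w\<in>D. f w < I + inverse (real (Suc n))" for n
  proof -
    have "Inf (f ` D) < I + inverse (real (Suc n))" by (simp add: I_def)
    then show ?thesis
      using ne bdd by (subst (asm) cInf_less_iff) auto
  qed
  then obtain w where w: "\<And>n. w n \<in> D" "\<And>n. f (w n) < I + inverse (real (Suc n))"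
    by metis
  define a where "a n = fst (w n)" for n
  have sq: "(norm (a m - a n))\<^sup>2 \<le> 2 * (inverse (real (Suc m)) + inverse (real (Suc n)))" for m n
  proof -
    have "I \<le> f (w m) / 2 + f (w n) / 2 - (norm (a m - a n))\<^sup>2 / 4"
      using seg[OF w(1) w(1), of "1/2" m n] by (simp add: a_def)
    then show ?thesis using w(2)[of m] w(2)[of n] by argo
  qed
  have "Cauchy a"
  proof (rule CauchyI)
    fix r :: real assume r: "0 < r"
    obtain N where N: "inverse (real (Suc N)) < r\<^sup>2 / 4"
      using reals_Archimedean[of "r\<^sup>2 / 4"] r by auto
    have "norm (a m - a n) < r" if "m \<ge> N" "n \<ge> N" for m n
    proof -
      have "inverse (real (Suc k)) \<le> inverse (real (Suc N))" if "k \<ge> N" for k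
        using that by (simp add: field_simps)
      from this[OF that(1)] this[OF that(2)] have "(norm (a m - a n))\<^sup>2 < r\<^sup>2"
        using sq[of m n] N by argo
      then show ?thesis using r by (simp add: power2_less_imp_less)
    qed
    then show "\<exists>M. \<forall>m\<ge>M. \<forall>n\<ge>M. norm (a m - a n) < r" by blast
  qed
  then obtain p where p: "a \<longlonglongrightarrow> p"
    using Cauchy_convergent convergent_def by blast
  have fw: "(\<lambda>n. f (w n)) \<longlonglongrightarrow> I"
  proof (rule tendsto_sandwich)
    show "\<forall>\<^sub>F n in sequentially. I \<le> f (w n)" using I_le w(1) by simp
    show "\<forall>\<^sub>F n in sequentially. f (w n) \<le> I + inverse (real (Suc n))"
      using w(2) by (simp add: less_imp_le)
    show "(\<lambda>n. I + inverse (real (Suc n))) \<longlonglongrightarrow> I"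
      using tendsto_add[OF tendsto_const LIMSEQ_inverse_real_of_nat, of I] by simp
  qed simp
  have "(norm (p - b))\<^sup>2 \<le> h + (norm b)\<^sup>2 - m" if bD: "(b, h) \<in> D" for b h
  proof -
    \<comment> \<open>Let \<open>n\<close> tend to infinity on the segment from \<open>w n\<close> to \<open>(b, h)\<close>, then divide by its parameter \<open>s\<close>.\<close>
    have small: "(1 - s) * (norm (p - b))\<^sup>2 \<le> f (b, h) - I" if s: "0 < s" "s < 1" for s
    proof -
      have "(\<lambda>n. (1 - s) * f (w n) + s * f (b, h) - s * (1 - s) * (norm (a n - b))\<^sup>2)
          \<longlonglongrightarrow> (1 - s) * I + s * f (b, h) - s * (1 - s) * (norm (p - b))\<^sup>2"
        by (intro tendsto_intros fw p)
      moreover have "I \<le> (1 - s) * f (w n) + s * f (b, h) - s * (1 - s) * (norm (a n - b))\<^sup>2" for n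
        using seg[OF w(1) bD, of s n] s by (simp add: a_def)
      ultimately have "I \<le> (1 - s) * I + s * f (b, h) - s * (1 - s) * (norm (p - b))\<^sup>2"
        by (intro LIMSEQ_le_const) auto
      then have "s * ((1 - s) * (norm (p - b))\<^sup>2) \<le> s * (f (b, h) - I)"
        by (simp add: algebra_simps)
      then show ?thesis using s by simp
    qed
    have "((\<lambda>s. (1 - s) * (norm (p - b))\<^sup>2) \<longlongrightarrow> (1 - 0) * (norm (p - b))\<^sup>2) (at_right (0::real))"
      by (intro tendsto_intros)
    moreover have "\<forall>\<^sub>F s in at_right (0::real). (1 - s) * (norm (p - b))\<^sup>2 \<le> f (b, h) - I"
      using small by (auto simp: eventually_at_right[of 0 1] intro!: exI[of _ 1])
    ultimately have "(1 - 0) * (norm (p - b))\<^sup>2 \<le> f (b, h) - I"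
      by (intro tendsto_upperbound) auto
    then show ?thesis using m_le by (simp add: f_def)
  qed
  then show ?thesis by blast
qed

text \<open>
  This is Kirszbraun's extension theorem in disguise: in the coordinates \<open>a = (y - v)/2\<close> and
  \<open>b = (y + v)/2\<close> the identity \<open>y \<bullet> v = \<parallel>b\<parallel>\<^sup>2 - \<parallel>a\<parallel>\<^sup>2\<close> turns monotonicity into nonexpansiveness of
  \<open>b \<mapsto> a\<close>, and the claim says that \<open>p\<close> is an admissible image of \<open>b = 0\<close>. Convexification keeps
  what is needed: \<open>Y \<bullet> V \<le> h\<close> on the convex hull of the lifted graph, hence
  \<open>h + \<parallel>(Y - V)/2\<parallel>\<^sup>2 \<ge> \<parallel>(Y + V)/2\<parallel>\<^sup>2 \<ge> 0\<close> there.
\<close>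

lemma Debrunner_Flor:
  fixes G :: "('a::{real_inner, complete_space} \<times> 'a) set"
  assumes mono: "\<And>y v y' v'. (y, v) \<in> G \<Longrightarrow> (y', v') \<in> G \<Longrightarrow> (y - y') \<bullet> (v - v') \<ge> 0"
  shows "\<exists>p. \<forall>(y, v)\<in>G. (p - y) \<bullet> (- p - v) \<ge> 0"
proof (cases "G = {}")
  case False
  define L where "L = (\<lambda>(y, v). (y, v, y \<bullet> v)) ` G"
  define C where "C = convex hull L"
  \<comment> \<open>For a fixed \<open>(Y, V, h)\<close> the relation to \<open>(Y', V', h')\<close> below cuts out a half-space. So it passes
    from the lifted graph to the convex hull in one argument, and then in the other.\<close>
  have halfspace: "convex {(Y', V', h'). Y \<bullet> V' + Y' \<bullet> V \<le> h + h'}" for Y V :: 'a and h :: real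
  proof -
    have "{(Y', V', h'). Y \<bullet> V' + Y' \<bullet> V \<le> h + h'} = {w. (V, Y, - 1) \<bullet> w \<le> h}"
      by (auto simp: inner_Pair inner_commute)
    then show ?thesis by (simp only: convex_halfspace_le)
  qed
  have graph_hull: "y \<bullet> V + Y \<bullet> v \<le> y \<bullet> v + h" if yv: "(y, v) \<in> G" and "(Y, V, h) \<in> C" for y v Y V h
  proof -
    have "L \<subseteq> {(Y', V', h'). y \<bullet> V' + Y' \<bullet> v \<le> y \<bullet> v + h'}"
      using mono[OF yv] by (auto simp: L_def inner_diff algebra_simps)
    then have "C \<subseteq> {(Y', V', h'). y \<bullet> V' + Y' \<bullet> v \<le> y \<bullet> v + h'}"
      unfolding C_def by (rule hull_minimal) (rule halfspace)
    then show ?thesis using that by blast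
  qed
  have hull_hull: "Y \<bullet> V' + Y' \<bullet> V \<le> h + h'" if "(Y, V, h) \<in> C" "(Y', V', h') \<in> C" for Y V h Y' V' h'
  proof -
    have "L \<subseteq> {(Y', V', h'). Y \<bullet> V' + Y' \<bullet> V \<le> h + h'}"
      using graph_hull[OF _ that(1)] by (force simp: L_def algebra_simps)
    then have "C \<subseteq> {(Y', V', h'). Y \<bullet> V' + Y' \<bullet> V \<le> h + h'}"
      unfolding C_def by (rule hull_minimal) (rule halfspace)
    then show ?thesis using that by blast
  qed
  define T :: "'a \<times> 'a \<times> real \<Rightarrow> 'a \<times> real"
    where "T = (\<lambda>(Y, V, h). ((1/2) *\<^sub>R (Y - V), h))"
  have "linear T"
    by (rule linearI) (auto simp: T_def algebra_simps split: prod.splits)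
  then have "convex (T ` C)"
    by (simp add: convex_linear_image C_def)
  moreover have "T ` C \<noteq> {}"
    using False by (simp add: C_def L_def)
  moreover have "0 \<le> h + (norm a)\<^sup>2" if ah: "(a, h) \<in> T ` C" for a h
  proof -
    obtain Y V where YV: "(Y, V, h) \<in> C" "a = (1/2) *\<^sub>R (Y - V)"
      using ah by (auto simp: T_def)
    have "0 \<le> (Y + V) \<bullet> (Y + V)" by simp
    then show ?thesis
      using hull_hull[OF YV(1) YV(1)] unfolding YV(2) power2_norm_eq_inner
      by (simp add: inner_diff inner_add inner_commute field_simps)
  qed
  ultimately obtain p where p: "\<forall>(a, h)\<in>T ` C. (norm (p - a))\<^sup>2 \<le> h + (norm a)\<^sup>2 - 0"
    using strongly_convex_minimiser[of "T ` C" 0] by blast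
  have "(p - y) \<bullet> (- p - v) \<ge> 0" if "(y, v) \<in> G" for y v
  proof -
    have "(y, v, y \<bullet> v) \<in> C"
      using that hull_subset[of L convex] by (force simp: C_def L_def)
    then have "((1/2) *\<^sub>R (y - v), y \<bullet> v) \<in> T ` C"
      by (force simp: T_def)
    then have "(norm (p - (1/2) *\<^sub>R (y - v)))\<^sup>2 \<le> y \<bullet> v + (norm ((1/2) *\<^sub>R (y - v)))\<^sup>2"
      using p by fastforce
    then show ?thesis
      unfolding power2_norm_eq_inner
      by (simp add: inner_diff inner_add inner_commute algebra_simps)
  qed
  then show ?thesis by blast
qed simp

lemma maximally_monotone_memI:
  assumes "maximally_monotone A"
    and rel: "\<And>y v. v \<in> A y \<Longrightarrow> (p - y) \<bullet> (u - v) \<ge> 0"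
  shows "u \<in> A p"
proof (rule ccontr)
  assume "u \<notin> A p"
  define B where "B = A(p := insert u (A p))"
  have mono: "monotone_op A" using assms(1) by (simp add: maximally_monotone_def)
  have rel': "(y - p) \<bullet> (v - u) \<ge> 0" if "v \<in> A y" for y v
    using rel[OF that] by (metis inner_minus_left inner_minus_right minus_diff_eq minus_minus)
  have "monotone_op B"
    using mono rel rel' unfolding monotone_op_def B_def by (auto split: if_splits)
  moreover have "op_graph A \<subset> op_graph B"
    using \<open>u \<notin> A p\<close> by (auto simp: op_graph_def B_def)
  ultimately show False using assms(1) by (auto simp: maximally_monotone_def)
qed

text \<open>
  Existence of the resolvent point is Minty's theorem. \<open>Debrunner_Flor\<close> is applied to the graph
  of \<open>y \<mapsto> c A y - x\<close>, because a zero of \<open>p \<mapsto> p + c A p - x\<close> is what is sought. By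
  monotonicity, the difference of two such zeros has nonpositive squared norm.
\<close>

lemma resolvent_mem:
  fixes A :: "'a::{real_inner, complete_space} \<Rightarrow> 'a set"
  assumes A: "maximally_monotone A" and c: "c > 0"
  shows "(1 / c) *\<^sub>R (x - resolvent c A x) \<in> A (resolvent c A x)"
proof -
  have mono: "(y - y') \<bullet> (v - v') \<ge> 0" if "v \<in> A y" "v' \<in> A y'" for y y' v v'
    using A that by (simp add: maximally_monotone_def monotone_op_def)
  have inverse_iff: "p \<in> op_inverse (id_plus_scaled c A) x \<longleftrightarrow> (1 / c) *\<^sub>R (x - p) \<in> A p" for p
    using c by (auto simp: op_inverse_def id_plus_scaled_def intro!: exI[of _ "(1 / c) *\<^sub>R (x - p)"])
  define G where "G = {(y, c *\<^sub>R v - x) | y v. v \<in> A y}"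
  have "\<exists>p. \<forall>(y, w)\<in>G. (p - y) \<bullet> (- p - w) \<ge> 0"
  proof (rule Debrunner_Flor)
    fix y w y' w' assume "(y, w) \<in> G" "(y', w') \<in> G"
    then obtain v v' where v: "v \<in> A y" "w = c *\<^sub>R v - x" "v' \<in> A y'" "w' = c *\<^sub>R v' - x"
      by (auto simp: G_def)
    have "(y - y') \<bullet> (w - w') = c * ((y - y') \<bullet> (v - v'))"
      by (simp add: v algebra_simps inner_diff)
    then show "(y - y') \<bullet> (w - w') \<ge> 0" using mono v c by simp
  qed
  then obtain p where p: "\<And>y w. (y, w) \<in> G \<Longrightarrow> (p - y) \<bullet> (- p - w) \<ge> 0"
    by blast
  have "(1 / c) *\<^sub>R (x - p) \<in> A p"
  proof (rule maximally_monotone_memI[OF A])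
    fix y v assume "v \<in> A y"
    then have "(p - y) \<bullet> (- p - (c *\<^sub>R v - x)) \<ge> 0"
      by (intro p) (auto simp: G_def)
    moreover have "- p - (c *\<^sub>R v - x) = c *\<^sub>R ((1 / c) *\<^sub>R (x - p) - v)"
      using c by (simp add: algebra_simps)
    ultimately show "(p - y) \<bullet> ((1 / c) *\<^sub>R (x - p) - v) \<ge> 0"
      using c by (simp add: zero_le_mult_iff)
  qed
  moreover have "q = p" if "(1 / c) *\<^sub>R (x - q) \<in> A q" "(1 / c) *\<^sub>R (x - p) \<in> A p" for p q
  proof -
    have "(q - p) \<bullet> ((1 / c) *\<^sub>R (x - q) - (1 / c) *\<^sub>R (x - p)) \<ge> 0"
      using mono that by blast
    moreover have "(1 / c) *\<^sub>R (x - q) - (1 / c) *\<^sub>R (x - p) = - ((1 / c) *\<^sub>R (q - p))"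
      by (simp add: algebra_simps)
    ultimately have "(1 / c) * ((q - p) \<bullet> (q - p)) \<le> 0"
      by simp
    then have "(q - p) \<bullet> (q - p) \<le> 0"
      using c by (simp add: divide_le_0_iff)
    then show ?thesis by (metis inner_gt_zero_iff linorder_not_less right_minus_eq)
  qed
  ultimately have "\<exists>!p. p \<in> op_inverse (id_plus_scaled c A) x"
    unfolding inverse_iff by blast
  from theI'[OF this] show ?thesis
    unfolding resolvent_def inverse_iff .
qed

section \<open>Zeros of a maximally monotone operator\<close>

lemma closed_zer:
  assumes A: "maximally_monotone A"
  shows "closed (zer A)"
proof -
  have "zer A = (\<Inter>(y, v)\<in>op_graph A. {z. 0 \<le> (z - y) \<bullet> (0 - v)})"
  proof (intro set_eqI iffI)
    fix z assume "z \<in> zer A"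
    then have "0 \<in> A z" by (simp add: zer_def op_inverse_def)
    then show "z \<in> (\<Inter>(y, v)\<in>op_graph A. {z. 0 \<le> (z - y) \<bullet> (0 - v)})"
      using A by (fastforce simp: op_graph_def maximally_monotone_def monotone_op_def)
  next
    fix z assume "z \<in> (\<Inter>(y, v)\<in>op_graph A. {z. 0 \<le> (z - y) \<bullet> (0 - v)})"
    then have "0 \<in> A z"
      by (intro maximally_monotone_memI[OF A]) (auto simp: op_graph_def)
    then show "z \<in> zer A" by (simp add: zer_def op_inverse_def)
  qed
  moreover have "closed {z. 0 \<le> (z - y) \<bullet> (0 - v)}" for y v :: 'a
    by (intro closed_Collect_le continuous_intros)
  ultimately show ?thesis by (auto intro!: closed_INT)
qed

text \<open>
  Expanding the square leaves, besides the stated terms, \<open>- 2 l (p - z) \<bullet> (x - p)\<close>. Monotonicity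
  between \<open>p\<close>, where \<open>(x - p) / c\<close> is a value of \<open>A\<close>, and the zero \<open>z\<close> makes it nonpositive.
\<close>

lemma relaxed_resolvent_step:
  fixes A :: "'a::{real_inner, complete_space} \<Rightarrow> 'a set" and x :: 'a
  assumes A: "maximally_monotone A" and c: "c > 0" and z: "z \<in> zer A" and l: "l \<ge> 0"
  defines "p \<equiv> resolvent c A x"
  shows "(norm ((1 - l) *\<^sub>R x + l *\<^sub>R p - z))\<^sup>2
    \<le> (norm (x - z))\<^sup>2 - l * (2 - l) * (norm (x - p))\<^sup>2"
proof -
  have "0 \<in> A z" using z by (simp add: zer_def op_inverse_def)
  then have "(p - z) \<bullet> ((1 / c) *\<^sub>R (x - p) - 0) \<ge> 0"
    using resolvent_mem[OF A c, of x] A unfolding p_def maximally_monotone_def monotone_op_def by blast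
  then have pz: "(p - z) \<bullet> (x - p) \<ge> 0"
    using c by (simp add: zero_le_divide_iff)
  have "(norm ((1 - l) *\<^sub>R x + l *\<^sub>R p - z))\<^sup>2
      = (norm (x - z))\<^sup>2 - l * (2 - l) * (norm (x - p))\<^sup>2 - 2 * l * ((p - z) \<bullet> (x - p))"
    unfolding power2_norm_eq_inner
    by (simp add: inner_diff inner_add inner_commute algebra_simps power2_eq_square)
  then show ?thesis using pz l by simp
qed

lemma infdist_zer_le:
  assumes sub: "edist_set y (op_inverse A 0) \<le> ereal kappa * edist_set 0 (A y)"
    and kappa: "kappa > 0" and u: "u \<in> A y"
  shows "infdist y (zer A) \<le> kappa * norm u"
proof -
  have "ereal (infdist y (zer A)) \<le> edist_set y (op_inverse A 0)"
    unfolding edist_set_def zer_def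
    by (intro INF_greatest) (auto simp: dist_norm[symmetric] intro: infdist_le)
  also note sub
  also have "edist_set 0 (A y) \<le> ereal (norm u)"
    unfolding edist_set_def by (rule INF_lower2[OF u]) simp
  then have "ereal kappa * edist_set 0 (A y) \<le> ereal kappa * ereal (norm u)"
    using kappa by (intro ereal_mult_left_mono) auto
  finally show ?thesis by simp
qed

section \<open>Convergence of the perturbed iteration\<close>

lemma contraction_with_summable_errors_tendsto_0:
  fixes d \<epsilon> :: "nat \<Rightarrow> real"
  assumes nonneg: "\<And>k. 0 \<le> d k" and \<epsilon>: "\<And>k. 0 \<le> \<epsilon> k" "summable \<epsilon>"
    and \<rho>: "\<rho> < 1"
    and step: "\<forall>\<^sub>F k in sequentially. d (Suc k) \<le> \<rho> * d k + \<epsilon> k"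
  shows "d \<longlonglongrightarrow> 0"
proof -
  obtain N where N: "\<And>k. k \<ge> N \<Longrightarrow> d (Suc k) \<le> \<rho> * d k + \<epsilon> k"
    using step by (auto simp: eventually_sequentially)
  \<comment> \<open>The step inequality telescopes after it is rewritten as
    \<open>(1 - \<rho>) d\<^sub>k \<le> d\<^sub>k - d\<^sub>k\<^sub>+\<^sub>1 + \<epsilon>\<^sub>k\<close>.\<close>
  have tele: "(1 - \<rho>) * (\<Sum>k<n. d (N + k)) \<le> d N - d (N + n) + (\<Sum>k<n. \<epsilon> (N + k))" for n
  proof (induction n)
    case (Suc n)
    then show ?case using N[of "N + n"] by (simp add: algebra_simps)
  qed simp
  have \<epsilon>N: "summable (\<lambda>k. \<epsilon> (N + k))"
    using summable_ignore_initial_segment[OF \<epsilon>(2), of N] by (simp add: add.commute)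
  have "summable (\<lambda>k. d (N + k))"
  proof (rule summableI_nonneg_bounded)
    fix n
    have "(\<Sum>k<n. \<epsilon> (N + k)) \<le> (\<Sum>k. \<epsilon> (N + k))"
      using \<epsilon> \<epsilon>N by (intro sum_le_suminf) auto
    then have "(1 - \<rho>) * (\<Sum>k<n. d (N + k)) \<le> d N + (\<Sum>k. \<epsilon> (N + k))"
      using tele[of n] nonneg[of "N + n"] by linarith
    then show "(\<Sum>k<n. d (N + k)) \<le> (d N + (\<Sum>k. \<epsilon> (N + k))) / (1 - \<rho>)"
      using \<rho> by (simp add: field_simps)
  qed (use nonneg in simp)
  then have "(\<lambda>k. d (N + k)) \<longlonglongrightarrow> 0" by (rule summable_LIMSEQ_zero)
  then show ?thesis by (simp add: LIMSEQ_ignore_initial_segment LIMSEQ_offset[of d N] add.commute)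
qed

text \<open>
  From index \<open>n\<close> on, the distance to a nearly closest point of \<open>Z\<close> hardly grows, so all later
  iterates lie within about \<open>2 d(x\<^sub>n, Z)\<close> of \<open>x\<^sub>n\<close>, up to the tail of the errors.
\<close>

lemma quasi_Fejer_convergent:
  fixes x :: "nat \<Rightarrow> 'a::{real_normed_vector, complete_space}"
  assumes Z: "closed Z" "Z \<noteq> {}" and \<epsilon>: "\<And>k. 0 \<le> \<epsilon> k" "summable \<epsilon>"
    and fejer: "\<And>z k. z \<in> Z \<Longrightarrow> norm (x (Suc k) - z) \<le> norm (x k - z) + \<epsilon> k"
    and dist0: "(\<lambda>k. infdist (x k) Z) \<longlonglongrightarrow> 0"
  shows "\<exists>z\<in>Z. x \<longlonglongrightarrow> z"
proof -
  have later: "norm (x (n + j) - z) \<le> norm (x n - z) + (\<Sum>i<j. \<epsilon> (i + n))" if "z \<in> Z" for z n j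
  proof (induction j)
    case (Suc j)
    then show ?case using fejer[OF that, of "n + j"] by (simp add: add.commute)
  qed simp
  define t where "t n = (\<Sum>i. \<epsilon> (i + n))" for n
  have t0: "t \<longlonglongrightarrow> 0"
    unfolding t_def using suminf_exist_split2[OF \<epsilon>(2)] .
  have near: "norm (x m - x n) \<le> 2 * infdist (x n) Z + t n" if "m \<ge> n" for m n
  proof -
    have "norm (x m - x n) - t n \<le> 2 * norm (x n - z)" if z: "z \<in> Z" for z
    proof -
      have "(\<Sum>i<m - n. \<epsilon> (i + n)) \<le> t n"
        unfolding t_def using \<epsilon> by (intro sum_le_suminf summable_ignore_initial_segment) auto
      then have "norm (x m - z) \<le> norm (x n - z) + t n"
        using later[OF z, of n "m - n"] \<open>m \<ge> n\<close> by simp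
      moreover have "norm (x m - x n) \<le> norm (x m - z) + norm (x n - z)"
        using norm_triangle_ineq4[of "x m - z" "x n - z"] by simp
      ultimately show ?thesis by linarith
    qed
    then have "(norm (x m - x n) - t n) / 2 \<le> infdist (x n) Z"
      unfolding infdist_notempty[OF Z(2)] dist_norm using Z(2)
      by (intro cINF_greatest) (auto simp: field_simps)
    then show ?thesis by simp
  qed
  have "(\<lambda>n. 2 * infdist (x n) Z + t n) \<longlonglongrightarrow> 2 * 0 + 0"
    by (intro tendsto_intros dist0 t0)
  then have bound0: "(\<lambda>n. 2 * infdist (x n) Z + t n) \<longlonglongrightarrow> 0" by simp
  have "Cauchy x"
  proof (rule metric_CauchyI)
    fix r :: real assume "0 < r"
    then obtain n where n: "2 * infdist (x n) Z + t n < r / 2"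
      using order_tendstoD(2)[OF bound0, of "r / 2"] by (auto simp: eventually_sequentially)
    have "dist (x i) (x j) < r" if "i \<ge> n" "j \<ge> n" for i j
      using near[OF that(1)] near[OF that(2)] n dist_triangle_half_l[of "x i" "x n" r "x j"]
      by (simp add: dist_norm norm_minus_commute)
    then show "\<exists>M. \<forall>m\<ge>M. \<forall>n\<ge>M. dist (x m) (x n) < r" by blast
  qed
  then obtain z where z: "x \<longlonglongrightarrow> z"
    using Cauchy_convergent convergent_def by blast
  have "(\<lambda>k. infdist (x k) Z) \<longlonglongrightarrow> infdist z Z"
    by (intro tendsto_infdist z)
  then have "infdist z Z = 0" using dist0 LIMSEQ_unique by blast
  then have "z \<in> Z" using in_closed_iff_infdist_zero[OF Z] by simp
  with z show ?thesis by blast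
qed

text \<open>
  A uniform decrease of the squared distance to every \<open>z \<in> Z\<close>, by at least a fraction \<open>\<beta>\<close> of
  \<open>d(x, Z)\<^sup>2\<close>, contracts the distance to \<open>Z\<close> itself: pass to the infimum over \<open>z\<close>. Truncating
  \<open>\<beta>\<close> at \<open>1\<close> keeps the radicand nonnegative.
\<close>

lemma infdist_contraction:
  fixes x y :: "'a::real_normed_vector"
  assumes Z: "Z \<noteq> {}" and \<beta>: "0 \<le> \<beta>"
    and dec: "\<And>z. z \<in> Z \<Longrightarrow> (norm (y - z))\<^sup>2 \<le> (norm (x - z))\<^sup>2 - \<beta> * (infdist x Z)\<^sup>2"
  shows "infdist y Z \<le> sqrt (1 - min \<beta> 1) * infdist x Z"
proof -
  let ?d = "infdist x Z"
  have "(infdist y Z)\<^sup>2 + \<beta> * ?d\<^sup>2 \<le> ?d\<^sup>2"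
  proof -
    have "sqrt ((infdist y Z)\<^sup>2 + \<beta> * ?d\<^sup>2) \<le> norm (x - z)" if z: "z \<in> Z" for z
    proof (rule real_le_lsqrt)
      have "infdist y Z \<le> norm (y - z)" using infdist_le[OF z, of y] by (simp add: dist_norm)
      then have "(infdist y Z)\<^sup>2 \<le> (norm (y - z))\<^sup>2" by (simp add: infdist_nonneg power_mono)
      then show "(infdist y Z)\<^sup>2 + \<beta> * ?d\<^sup>2 \<le> (norm (x - z))\<^sup>2" using dec[OF z] by linarith
    qed (use \<beta> in simp)
    then have "sqrt ((infdist y Z)\<^sup>2 + \<beta> * ?d\<^sup>2) \<le> ?d"
      unfolding infdist_notempty[OF Z, of x] dist_norm using Z by (intro cINF_greatest) auto
    then show ?thesis by (simp add: sqrt_le_D)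
  qed
  moreover have "min \<beta> 1 * ?d\<^sup>2 \<le> \<beta> * ?d\<^sup>2" by (simp add: mult_right_mono)
  ultimately have "(infdist y Z)\<^sup>2 \<le> (1 - min \<beta> 1) * ?d\<^sup>2" by (simp add: algebra_simps)
  then have "sqrt ((infdist y Z)\<^sup>2) \<le> sqrt ((1 - min \<beta> 1) * ?d\<^sup>2)" by (rule real_sqrt_le_mono)
  then show ?thesis by (simp add: real_sqrt_mult infdist_nonneg)
qed

theorem theorem5p10:
  fixes A :: "'a::{real_inner, complete_space} \<Rightarrow> 'a set"
    and xbar :: 'a
    and kappa delta tau :: real
    and lam c eta :: "nat \<Rightarrow> real"
    and e x :: "nat \<Rightarrow> 'a"
  assumes maxmon: "maximally_monotone A"
    and zer_nonempty: "zer A \<noteq> {}"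
    and xbar: "xbar \<in> zer A"
    and kappa: "kappa > 0"
    and delta: "delta > 0"
    and subregular: "\<forall>y\<in>cball xbar delta.
          edist_set y (op_inverse A 0) \<le> ereal kappa * edist_set 0 (A y)"
    and lam: "\<forall>k. lam k \<in> {0<..<2}"
    and c: "\<forall>k. c k > 0"
    and eta: "\<forall>k. eta k \<ge> 0"
    and tau: "tau > 0"
    and errors: "ereal tau + (\<Sum>k. ereal (eta k * norm (e k))) \<le> ereal delta"
    and x0: "x 0 \<in> cball xbar tau"
    and step: "\<forall>k. x (Suc k) =
          (1 - lam k) *\<^sub>R x k + lam k *\<^sub>R resolvent (c k) A (x k) + eta k *\<^sub>R e k"
    and inf_c: "(INF k. c k) > 0"
    and liminf_lam: "0 < liminf (\<lambda>k. ereal (lam k))"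
    and limsup_lam: "limsup (\<lambda>k. ereal (lam k)) < 2"
  shows "\<exists>z\<in>zer A. x \<longlonglongrightarrow> z"
proof -
  let ?Z = "zer A"
  define p where "p k = resolvent (c k) A (x k)" for k
  define y where "y k = (1 - lam k) *\<^sub>R x k + lam k *\<^sub>R p k" for k
  define \<epsilon> where "\<epsilon> k = eta k * norm (e k)" for k
  have lam': "0 < lam k" "lam k < 2" for k using lam by auto
  have \<epsilon>0: "0 \<le> \<epsilon> k" for k using eta by (simp add: \<epsilon>_def)
  have x_Suc: "x (Suc k) = y k + eta k *\<^sub>R e k" for k
    using step by (simp add: y_def p_def)
  have x_y: "norm (x (Suc k) - y k) = \<epsilon> k" for k
    using eta by (simp add: x_Suc \<epsilon>_def)

  have partial: "tau + (\<Sum>k<n. \<epsilon> k) \<le> delta" for n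
  proof -
    have "(\<Sum>k<n. ereal (\<epsilon> k)) \<le> (\<Sum>k. ereal (\<epsilon> k))"
      using \<epsilon>0 by (intro suminf_upper) simp
    then have "ereal tau + (\<Sum>k<n. ereal (\<epsilon> k)) \<le> ereal delta"
      using errors unfolding \<epsilon>_def by (meson add_left_mono order_trans)
    then show ?thesis by simp
  qed
  have sum_\<epsilon>: "summable \<epsilon>"
  proof (rule summableI_nonneg_bounded)
    show "(\<Sum>k<n. \<epsilon> k) \<le> delta - tau" for n using partial[of n] by simp
  qed (rule \<epsilon>0)

  have decrease: "(norm (y k - z))\<^sup>2 \<le> (norm (x k - z))\<^sup>2 - lam k * (2 - lam k) * (norm (x k - p k))\<^sup>2"
    if "z \<in> ?Z" for k z
    unfolding y_def p_def using relaxed_resolvent_step[OF maxmon _ that] c lam'(1)[of k]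
    by (simp add: less_imp_le)
  have fejer: "norm (x (Suc k) - z) \<le> norm (x k - z) + \<epsilon> k" if z: "z \<in> ?Z" for k z
  proof -
    have "0 \<le> lam k * (2 - lam k) * (norm (x k - p k))\<^sup>2"
      using lam'[of k] by simp
    then have "(norm (y k - z))\<^sup>2 \<le> (norm (x k - z))\<^sup>2" using decrease[OF z, of k] by linarith
    then have "norm (y k - z) \<le> norm (x k - z)" by (rule power2_le_imp_le) simp
    moreover have "norm (x (Suc k) - z) \<le> norm (x (Suc k) - y k) + norm (y k - z)"
      using norm_triangle_ineq[of "x (Suc k) - y k" "y k - z"] by simp
    ultimately show ?thesis using x_y[of k] by simp
  qed
  have x_ball: "norm (x k - xbar) \<le> delta" for k
  proof -
    have "norm (x k - xbar) \<le> tau + (\<Sum>i<k. \<epsilon> i)"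
    proof (induction k)
      case 0
      then show ?case using x0 by (simp add: dist_norm norm_minus_commute)
    next
      case (Suc k)
      then show ?case using fejer[OF xbar, of k] by simp
    qed
    then show ?thesis using partial[of k] by linarith
  qed
  have p_ball: "p k \<in> cball xbar delta" for k
  proof -
    \<comment> \<open>The full resolvent step is the relaxed step with parameter \<open>1\<close>.\<close>
    have "(norm (p k - xbar))\<^sup>2 \<le> (norm (x k - xbar))\<^sup>2 - (norm (x k - p k))\<^sup>2"
      using relaxed_resolvent_step[OF maxmon _ xbar, of "c k" 1 "x k"] c by (simp add: p_def)
    then have "(norm (p k - xbar))\<^sup>2 \<le> (norm (x k - xbar))\<^sup>2"
      by (smt (verit) zero_le_power2)
    then have "norm (p k - xbar) \<le> norm (x k - xbar)" by (rule power2_le_imp_le) simp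
    then show ?thesis using x_ball[of k] by (simp add: dist_norm norm_minus_commute)
  qed

  define \<gamma> where "\<gamma> = (INF k. c k)"
  have \<gamma>0: "\<gamma> > 0" using inf_c by (simp add: \<gamma>_def)
  have c_ge: "\<gamma> \<le> c k" for k
    unfolding \<gamma>_def using c by (intro cINF_lower bdd_belowI2[of _ 0]) (auto intro: less_imp_le)
  define M where "M = 1 + kappa / \<gamma>"
  have M0: "M > 0" using kappa \<gamma>0 by (simp add: M_def add_pos_pos)
  have error_bound: "infdist (x k) ?Z \<le> M * norm (x k - p k)" for k
  proof -
    have "(1 / c k) *\<^sub>R (x k - p k) \<in> A (p k)"
      unfolding p_def using resolvent_mem[OF maxmon] c by blast
    then have "infdist (p k) ?Z \<le> kappa * norm ((1 / c k) *\<^sub>R (x k - p k))"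
      using subregular p_ball kappa by (intro infdist_zer_le) auto
    also have "\<dots> = kappa * norm (x k - p k) / c k"
      using c by (simp add: less_imp_le)
    also have "\<dots> \<le> kappa * norm (x k - p k) / \<gamma>"
      using c_ge[of k] \<gamma>0 kappa by (intro divide_left_mono) auto
    finally have "infdist (p k) ?Z \<le> kappa / \<gamma> * norm (x k - p k)" by simp
    then show ?thesis
      using infdist_triangle[of "x k" ?Z "p k"] by (simp add: M_def dist_norm algebra_simps)
  qed

  obtain l where l: "0 < l" "\<forall>\<^sub>F k in sequentially. l < lam k"
  proof -
    obtain l where l: "0 < ereal l" "ereal l < liminf (\<lambda>k. ereal (lam k))"
      using ereal_dense2[OF liminf_lam] by auto
    show thesis using that[of l] l less_LiminfD[OF l(2)] by simp
  qed
  obtain u where u: "u < 2" "\<forall>\<^sub>F k in sequentially. lam k < u"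
  proof -
    obtain u where u: "limsup (\<lambda>k. ereal (lam k)) < ereal u" "ereal u < 2"
      using ereal_dense2[OF limsup_lam] by auto
    show thesis using that[of u] u Limsup_lessD[OF u(1)] by simp
  qed
  define \<beta> where "\<beta> = l * (2 - u) / M\<^sup>2"
  define \<rho> where "\<rho> = sqrt (1 - min \<beta> 1)"
  have \<beta>0: "\<beta> > 0" using l u M0 by (simp add: \<beta>_def)
  then have \<rho>1: "\<rho> < 1" by (simp add: \<rho>_def)
  have contract: "infdist (x (Suc k)) ?Z \<le> \<rho> * infdist (x k) ?Z + \<epsilon> k"
    if "l < lam k" "lam k < u" for k
  proof -
    have "infdist (y k) ?Z \<le> \<rho> * infdist (x k) ?Z"
      unfolding \<rho>_def
    proof (rule infdist_contraction[OF zer_nonempty])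
      fix z assume z: "z \<in> ?Z"
      have "(infdist (x k) ?Z)\<^sup>2 \<le> (M * norm (x k - p k))\<^sup>2"
        using error_bound by (simp add: infdist_nonneg power_mono)
      then have "\<beta> * (infdist (x k) ?Z)\<^sup>2 \<le> \<beta> * (M * norm (x k - p k))\<^sup>2"
        using \<beta>0 by simp
      also have "\<dots> = l * (2 - u) * (norm (x k - p k))\<^sup>2"
        using M0 by (simp add: \<beta>_def power_mult_distrib)
      also have "\<dots> \<le> lam k * (2 - lam k) * (norm (x k - p k))\<^sup>2"
        using that l u lam'[of k] by (intro mult_right_mono mult_mono) auto
      finally show "(norm (y k - z))\<^sup>2 \<le> (norm (x k - z))\<^sup>2 - \<beta> * (infdist (x k) ?Z)\<^sup>2"
        using decrease[OF z, of k] by linarith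
    qed (use \<beta>0 in simp)
    then show ?thesis
      using infdist_triangle[of "x (Suc k)" ?Z "y k"] x_y[of k] by (simp add: dist_norm)
  qed
  have "(\<lambda>k. infdist (x k) ?Z) \<longlonglongrightarrow> 0"
  proof (rule contraction_with_summable_errors_tendsto_0[OF _ \<epsilon>0 sum_\<epsilon> \<rho>1])
    show "\<forall>\<^sub>F k in sequentially. infdist (x (Suc k)) ?Z \<le> \<rho> * infdist (x k) ?Z + \<epsilon> k"
      using l(2) u(2) by eventually_elim (rule contract)
  qed (rule infdist_nonneg)
  then show ?thesis
    using quasi_Fejer_convergent[OF closed_zer[OF maxmon] zer_nonempty \<epsilon>0 sum_\<epsilon> fejer] by blast
qed

end
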